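(* Let $2\le m\le n$ be integers, let $\mathcal{H}$ be the $m\times n$ half-rectangular grid, and let $P=(x_0,y_0)\in\mathcal{H}$. Then the minimum number of lines in $\mathbb{R}^2$ such that every point of $\mathcal{H}\setminus\{P\}$ lies on at least one of the lines and no line passes through $P$ equals $$n-\left\lceil \frac{n-m}{m-1}\,y_0\right\rceil-1.$$
   Context: For positive integers $m\le n$, the $m\times n$ half-rectangular grid is the set of all integer points $(x,y)\in\mathbb{Z}^2$ with $0\le x\le n-1$, $0\le y\le m-1$ and $(m-1)x+(n-1)y\le (m-1)(n-1)$. *)

theory Defs
  imports "HOL-Analysis.Analysis"
begin

definition half_rect_grid :: "int \<Rightarrow> int \<Rightarrow> (int \<times> int) set" where
  "half_rect_grid m n =
     {(x, y). 0 \<le> x \<and> x \<le> n - 1 \<and> 0 \<le> y \<and> y \<le> m - 1 \<and>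
              (m - 1) * x + (n - 1) * y \<le> (m - 1) * (n - 1)}"

definition real_point :: "int \<times> int \<Rightarrow> real \<times> real" where
  "real_point p = (real_of_int (fst p), real_of_int (snd p))"

definition is_line :: "(real \<times> real) set \<Rightarrow> bool" where
  "is_line l \<longleftrightarrow> affine l \<and> aff_dim l = 1"

definition covers_all_but ::
    "(real \<times> real) set set \<Rightarrow> (int \<times> int) set \<Rightarrow> int \<times> int \<Rightarrow> bool" where
  "covers_all_but L H P \<longleftrightarrow>
     finite L \<and> (\<forall>l\<in>L. is_line l) \<and>
     (\<forall>Q \<in> H - {P}. \<exists>l\<in>L. real_point Q \<in> l) \<and>
     (\<forall>l\<in>L. real_point P \<notin> l)"

text \<open>
  The minimum is attained and is a lower bound; unlike \<open>LEAST\<close> or \<open>Inf\<close>, this asserts existence.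
\<close>

definition is_min_cover_number :: "(int \<times> int) set \<Rightarrow> int \<times> int \<Rightarrow> int \<Rightarrow> bool" where
  "is_min_cover_number H P k \<longleftrightarrow>
     (\<exists>L. covers_all_but L H P \<and> int (card L) = k) \<and>
     (\<forall>L. covers_all_but L H P \<longrightarrow> k \<le> int (card L))"

end

theory Submission
  imports Defs
begin

text \<open>
  Write \<open>K\<close> for the claimed minimum. It is the largest integer \<open>z\<close> with
  \<open>(m - 1) z + (n - m) y0 \<le> (m - 1) (n - 1)\<close>.

  Upper bound: the \<open>y0\<close> horizontal lines below \<open>P\<close>, the \<open>x0\<close> vertical lines to the left of \<open>P\<close>,
  and the antidiagonals \<open>x + y = c\<close> with \<open>x0 + y0 < c \<le> K\<close> cover everything except \<open>P\<close>, because
  \<open>x + y \<le> K\<close> for all grid points with \<open>y \<ge> y0\<close>.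

  Lower bound: the grid contains the rectangle \<open>[0, K - y0] \<times> [0, y0]\<close>, which contains \<open>P\<close>.
  Multiplying the equations of \<open>d\<close> covering lines gives a polynomial of degree \<open>d\<close> that vanishes
  on this rectangle except at \<open>P\<close>. Its mixed difference of order \<open>(K - y0, y0)\<close> at the origin is
  then a nonzero multiple of its value at \<open>P\<close>, whereas it would be zero if \<open>d < K\<close>.
\<close>

section \<open>Iterated differences of sequences\<close>

definition seq_diff :: "(nat \<Rightarrow> real) \<Rightarrow> nat \<Rightarrow> real" where
  "seq_diff g x = g x - g (Suc x)"

lemma funpow_seq_diff_Suc:
  "(seq_diff ^^ Suc a) g x = (seq_diff ^^ a) g x - (seq_diff ^^ a) g (Suc x)"
  by (simp add: seq_diff_def)

lemma funpow_seq_diff_minus: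
  "(seq_diff ^^ a) (\<lambda>i. g i - h i) x = (seq_diff ^^ a) g x - (seq_diff ^^ a) h x"
  by (induction a arbitrary: x) (auto simp: seq_diff_def)

lemma funpow_seq_diff_eq_0:
  assumes "\<And>i. i \<le> a \<Longrightarrow> g (x + i) = 0"
  shows "(seq_diff ^^ a) g x = 0"
  using assms
proof (induction a arbitrary: x)
  case 0
  then show ?case by (metis add.right_neutral funpow_0 order_refl)
next
  case (Suc a)
  have "g (Suc x + i) = 0" if "i \<le> a" for i
    using Suc.prems[of "Suc i"] that by simp
  then show ?case
    using Suc.IH[of x] Suc.IH[of "Suc x"] Suc.prems
    unfolding funpow_seq_diff_Suc by simp
qed

text \<open>The iterated difference is an alternating binomial sum, built up by Pascal's rule, and
  only the term at \<open>k\<close> survives. The case \<open>k > a\<close>, where the coefficient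
  is 0, is included because the induction needs \<open>k = Suc a\<close>.\<close>

lemma funpow_seq_diff_single:
  assumes "\<And>i. i \<le> a \<Longrightarrow> i \<noteq> k \<Longrightarrow> g (x + i) = 0"
  shows "(seq_diff ^^ a) g x = (- 1) ^ k * real (a choose k) * g (x + k)"
  using assms
proof (induction a arbitrary: x k)
  case 0
  then show ?case by (cases k) (auto dest: spec[of _ 0])
next
  case (Suc a)
  have first: "(seq_diff ^^ a) g x = (- 1) ^ k * real (a choose k) * g (x + k)"
    using Suc.IH[of k x] Suc.prems by simp
  show ?case
  proof (cases k)
    case 0
    have "g (Suc x + i) = 0" if "i \<le> a" for i
      using Suc.prems[of "Suc i"] that 0 by simp
    then have "(seq_diff ^^ a) g (Suc x) = 0"
      by (rule funpow_seq_diff_eq_0)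
    then show ?thesis using first 0 unfolding funpow_seq_diff_Suc by simp
  next
    case (Suc k')
    have "g (Suc x + i) = 0" if "i \<le> a" "i \<noteq> k'" for i
      using Suc.prems[of "Suc i"] that Suc by simp
    then have "(seq_diff ^^ a) g (Suc x) = (- 1) ^ k' * real (a choose k') * g (Suc x + k')"
      by (rule Suc.IH)
    then show ?thesis using first Suc unfolding funpow_seq_diff_Suc
      by (simp add: algebra_simps)
  qed
qed

section \<open>Degree in two variables via differences\<close>

text \<open>For polynomial \<open>f\<close>, this says that the total degree of \<open>f\<close> is less than \<open>d\<close>.\<close>

fun diff_degree_less :: "nat \<Rightarrow> (nat \<Rightarrow> nat \<Rightarrow> real) \<Rightarrow> bool" where
  "diff_degree_less 0 f \<longleftrightarrow> (\<forall>x y. f x y = 0)"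
| "diff_degree_less (Suc d) f \<longleftrightarrow>
     diff_degree_less d (\<lambda>x y. f x y - f (Suc x) y) \<and>
     diff_degree_less d (\<lambda>x y. f x y - f x (Suc y))"

lemma diff_degree_less_linear:
  assumes "diff_degree_less d f" "diff_degree_less d g"
  shows "diff_degree_less d (\<lambda>x y. r * f x y + s * g x y)"
  using assms
proof (induction d arbitrary: f g)
  case (Suc d)
  have "diff_degree_less d (\<lambda>x y. r * (f x y - f (Suc x) y) + s * (g x y - g (Suc x) y))"
    and "diff_degree_less d (\<lambda>x y. r * (f x y - f x (Suc y)) + s * (g x y - g x (Suc y)))"
    using Suc.prems by (auto intro!: Suc.IH)
  then show ?case by (simp add: algebra_simps)
qed simp

lemma diff_degree_less_shift:
  assumes "diff_degree_less d f"
  shows "diff_degree_less d (\<lambda>x y. f (x + i) (y + j))"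
  using assms
proof (induction d arbitrary: f)
  case (Suc d)
  then show ?case
    using Suc.IH[of "\<lambda>x y. f x y - f (Suc x) y"] Suc.IH[of "\<lambda>x y. f x y - f x (Suc y)"]
    by simp
qed simp

lemma diff_degree_less_mono:
  assumes "diff_degree_less d f" "d \<le> e"
  shows "diff_degree_less e f"
proof -
  have "diff_degree_less (Suc d) f" if "diff_degree_less d f" for d f
    using that
  proof (induction d arbitrary: f)
    case (Suc d)
    then have "diff_degree_less d (\<lambda>x y. f x y - f (Suc x) y)"
      and "diff_degree_less d (\<lambda>x y. f x y - f x (Suc y))"
      by simp_all
    then show ?case
      by (subst diff_degree_less.simps(2)) (blast intro: Suc.IH)
  qed simp
  with assms(2,1) show ?thesis
    by (induction e rule: dec_induct) blast+
qed

text \<open>Product rule: for an affine form \<open>l\<close> with slope \<open>p\<close> in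
  \<open>x\<close>, the difference of \<open>l * f\<close> in direction \<open>x\<close> is
  \<open>l\<close> times the difference of \<open>f\<close>, minus \<open>p\<close> times the
  shifted \<open>f\<close>. Direction \<open>y\<close> is analogous with \<open>q\<close>.\<close>

lemma diff_degree_less_mult_affine:
  assumes "diff_degree_less d f"
  shows "diff_degree_less (Suc d) (\<lambda>x y. (p * real x + q * real y + r) * f x y)"
  using assms
proof (induction d arbitrary: f)
  case (Suc d)
  let ?l = "\<lambda>x y. p * real x + q * real y + r"
  have x: "diff_degree_less (Suc d) (\<lambda>x y. f (Suc x) y)"
    using diff_degree_less_shift[OF Suc.prems, of 1 0] by simp
  have y: "diff_degree_less (Suc d) (\<lambda>x y. f x (Suc y))"
    using diff_degree_less_shift[OF Suc.prems, of 0 1] by simp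
  have "diff_degree_less (Suc d) (\<lambda>x y. 1 * (?l x y * (f x y - f (Suc x) y)) + (- p) * f (Suc x) y)"
    using Suc.prems x by (intro diff_degree_less_linear Suc.IH) auto
  moreover have "diff_degree_less (Suc d)
      (\<lambda>x y. 1 * (?l x y * (f x y - f x (Suc y))) + (- q) * f x (Suc y))"
    using Suc.prems y by (intro diff_degree_less_linear Suc.IH) auto
  ultimately show ?case
    unfolding diff_degree_less.simps(2)[of "Suc d"]
    by (simp add: algebra_simps del: diff_degree_less.simps)
qed simp

lemma diff_degree_less_prod_affine:
  assumes "finite L"
  shows "diff_degree_less (Suc (card L)) (\<lambda>x y. \<Prod>l\<in>L. p l * real x + q l * real y + r l)"
  using assms
proof (induction L rule: finite_induct)
  case (insert l L)
  then show ?case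
    using diff_degree_less_mult_affine[OF insert.IH, of "p l" "q l" "r l"]
    by (simp del: diff_degree_less.simps)
qed simp

lemma mixed_diff_eq_0:
  assumes "diff_degree_less (a + b) f"
  shows "(seq_diff ^^ a) (\<lambda>x. (seq_diff ^^ b) (f x) y) x = 0"
  using assms
proof (induction a arbitrary: f)
  case 0
  then have "diff_degree_less b f" by simp
  then have "(seq_diff ^^ b) (f x) y = 0" for x
  proof (induction b arbitrary: f)
    case (Suc b)
    have "(seq_diff ^^ b) (\<lambda>y. f x y - f x (Suc y)) y = 0"
      using Suc.prems by (intro Suc.IH) auto
    moreover have "seq_diff (f x) = (\<lambda>y. f x y - f x (Suc y))"
      by (simp add: seq_diff_def fun_eq_iff)
    ultimately show ?case by (simp del: funpow.simps(2) add: funpow_Suc_right)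
  qed simp
  then show ?case by simp
next
  case (Suc a)
  have "(seq_diff ^^ a) (\<lambda>x. (seq_diff ^^ b) (\<lambda>y. f x y - f (Suc x) y) y) x = 0"
    using Suc.prems by (intro Suc.IH) auto
  \<comment> \<open>By linearity the innermost \<open>x\<close>-difference passes through the
    \<open>y\<close>-differences and lands on \<open>f\<close>, where the recursion of
    \<open>diff_degree_less\<close> applies.\<close>
  moreover have "seq_diff (\<lambda>x. (seq_diff ^^ b) (f x) y) =
      (\<lambda>x. (seq_diff ^^ b) (\<lambda>y. f x y - f (Suc x) y) y)"
    by (simp add: funpow_seq_diff_minus seq_diff_def fun_eq_iff)
  ultimately show ?case by (simp del: funpow.simps(2) add: funpow_Suc_right)
qed

lemma degree_ge_if_vanishes_except:
  assumes deg: "diff_degree_less (Suc d) f"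
    and "i0 \<le> a" "j0 \<le> b" "f i0 j0 \<noteq> 0"
    and zero: "\<And>i j. i \<le> a \<Longrightarrow> j \<le> b \<Longrightarrow> (i, j) \<noteq> (i0, j0) \<Longrightarrow> f i j = 0"
  shows "a + b \<le> d"
proof (rule ccontr)
  assume "\<not> a + b \<le> d"
  then have "diff_degree_less (a + b) f"
    using deg diff_degree_less_mono by (meson not_less_eq_eq)
  then have "(seq_diff ^^ a) (\<lambda>x. (seq_diff ^^ b) (f x) 0) 0 = 0"
    by (rule mixed_diff_eq_0)
  \<comment> \<open>Only the values at \<open>x = i0\<close> contribute to the outer difference, and
    among those only \<open>y = j0\<close> to the inner one. Both binomial coefficients are nonzero
    since \<open>i0 \<le> a\<close> and \<open>j0 \<le> b\<close>.\<close>
  moreover have "(seq_diff ^^ b) (f i) 0 = 0" if "i \<le> a" "i \<noteq> i0" for i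
    using that zero by (intro funpow_seq_diff_eq_0) auto
  then have "(seq_diff ^^ a) (\<lambda>x. (seq_diff ^^ b) (f x) 0) 0 =
      (- 1) ^ i0 * real (a choose i0) * (seq_diff ^^ b) (f i0) 0"
    using funpow_seq_diff_single[of a i0 "\<lambda>x. (seq_diff ^^ b) (f x) 0" 0] by simp
  moreover have "(seq_diff ^^ b) (f i0) 0 = (- 1) ^ j0 * real (b choose j0) * f i0 j0"
    using funpow_seq_diff_single[of b j0 "f i0" 0] zero assms(2) by simp
  ultimately show False
    using assms(2-4) by (simp add: binomial_eq_0_iff)
qed

section \<open>Lines and the lower bound on a rectangle\<close>

text \<open>In the plane, affine dimension 1 is codimension 1, so lines are exactly the hyperplanes;
  \<open>r\<close> is the negated offset.\<close>

lemma is_line_iff_equation: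
  "is_line l \<longleftrightarrow> (\<exists>p q r. (p, q) \<noteq> (0, 0) \<and> l = {(x, y). p * x + q * y + r = 0})"
proof
  assume "is_line l"
  then have "affine hull l = l" "aff_dim l = 1"
    by (simp_all add: is_line_def affine_hull_eq)
  then have "\<exists>u b. u \<noteq> 0 \<and> l = {z. u \<bullet> z = b}"
    using aff_dim_eq_hyperplane[of l] by (simp del: affine_hull_eq)
  then obtain u b where "u \<noteq> 0" "l = {z. u \<bullet> z = b}"
    by blast
  then show "\<exists>p q r. (p, q) \<noteq> (0, 0) \<and> l = {(x, y). p * x + q * y + r = 0}"
    by (intro exI[of _ "fst u"] exI[of _ "snd u"] exI[of _ "- b"])
       (auto simp: inner_prod_def zero_prod_def)
next
  assume "\<exists>p q r. (p, q) \<noteq> (0, 0) \<and> l = {(x, y). p * x + q * y + r = 0}"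
  then obtain p q r where "(p, q) \<noteq> (0, 0)" "l = {(x, y). p * x + q * y + r = 0}"
    by blast
  then have "(p, q) \<noteq> 0" "l = {z. (p, q) \<bullet> z = - r}"
    by (auto simp: inner_prod_def zero_prod_def)
  then show "is_line l"
    by (simp add: is_line_def affine_hyperplane aff_dim_hyperplane)
qed

lemma card_cover_rectangle_ge:
  assumes cov: "covers_all_but L H (x0, y0)"
    and "0 \<le> x0" "x0 \<le> a" "0 \<le> y0" "y0 \<le> b"
    and sub: "{0..a} \<times> {0..b} \<subseteq> H"
  shows "a + b \<le> int (card L)"
proof -
  have fin: "finite L" using cov by (simp add: covers_all_but_def)
  have "\<forall>l\<in>L. \<exists>p q r. l = {(x, y). p * x + q * y + r = 0}"
    using cov unfolding covers_all_but_def is_line_iff_equation by blast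
  then obtain p q r where eq: "\<And>l. l \<in> L \<Longrightarrow> l = {(x, y). p l * x + q l * y + r l = 0}"
    by metis
  define f where "f = (\<lambda>x y. \<Prod>l\<in>L. p l * real x + q l * real y + r l)"
  have f_eq_0_iff: "f (nat x) (nat y) = 0 \<longleftrightarrow> (\<exists>l\<in>L. real_point (x, y) \<in> l)"
    if "0 \<le> x" "0 \<le> y" for x y
  proof -
    have "p l * real (nat x) + q l * real (nat y) + r l = 0 \<longleftrightarrow> real_point (x, y) \<in> l"
      if "l \<in> L" for l
      \<comment> \<open>Only the fourth \<open>l\<close>, the set in the membership, is to be
        rewritten; the first three are arguments of \<open>p\<close>, \<open>q\<close> and
        \<open>r\<close>.\<close>
      using \<open>0 \<le> x\<close> \<open>0 \<le> y\<close> by (subst (4) eq[OF that]) (simp add: real_point_def)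
    then show ?thesis using fin by (auto simp: f_def)
  qed
  have "nat a + nat b \<le> card L"
  proof (rule degree_ge_if_vanishes_except)
    show "diff_degree_less (Suc (card L)) f"
      unfolding f_def using fin by (rule diff_degree_less_prod_affine)
    show "nat x0 \<le> nat a" "nat y0 \<le> nat b" using assms by auto
    show "f (nat x0) (nat y0) \<noteq> 0"
      using assms f_eq_0_iff[of x0 y0] by (auto simp: covers_all_but_def)
    fix i j assume ij: "i \<le> nat a" "j \<le> nat b" "(i, j) \<noteq> (nat x0, nat y0)"
    then have "(int i, int j) \<in> H - {(x0, y0)}"
      using sub assms by auto
    then show "f i j = 0"
      using cov f_eq_0_iff[of "int i" "int j"] by (auto simp: covers_all_but_def)
  qed
  then show ?thesis using assms by linarith
qed

section \<open>An explicit cover\<close>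

definition axis_diagonal_lines :: "int \<Rightarrow> int \<Rightarrow> int \<Rightarrow> (real \<times> real) set set" where
  "axis_diagonal_lines x0 y0 k =
     (\<lambda>c. {(x, y). y = real_of_int c}) ` {0..<y0} \<union>
     (\<lambda>c. {(x, y). x = real_of_int c}) ` {0..<x0} \<union>
     (\<lambda>c. {(x, y). x + y = real_of_int c}) ` {x0 + y0<..k}"

text \<open>The families have at most \<open>y0\<close>, \<open>x0\<close> and
  \<open>k - x0 - y0\<close> members. An upper estimate suffices, so disjointness need not be
  shown.\<close>

lemma card_axis_diagonal_lines_le:
  assumes "0 \<le> x0" "0 \<le> y0" "x0 + y0 \<le> k"
  shows "int (card (axis_diagonal_lines x0 y0 k)) \<le> k"
proof -
  have "card (axis_diagonal_lines x0 y0 k) \<le> card {0..<y0} + card {0..<x0} + card {x0 + y0<..k}"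
    unfolding axis_diagonal_lines_def
    by (intro card_Un_le[THEN order_trans] add_mono card_image_le) auto
  then show ?thesis using assms by simp
qed

lemma axis_diagonal_lines_cover:
  assumes "\<And>x y. (x, y) \<in> H \<Longrightarrow> 0 \<le> x \<and> 0 \<le> y \<and> (y0 \<le> y \<longrightarrow> x + y \<le> k)"
  shows "covers_all_but (axis_diagonal_lines x0 y0 k) H (x0, y0)"
  unfolding covers_all_but_def
proof (intro conjI ballI)
  show "finite (axis_diagonal_lines x0 y0 k)"
    by (simp add: axis_diagonal_lines_def)
next
  fix l assume "l \<in> axis_diagonal_lines x0 y0 k"
  then consider c where "l = {(x, y). 0 * x + 1 * y + (- real_of_int c) = 0}"
    | c where "l = {(x, y). 1 * x + 0 * y + (- real_of_int c) = 0}"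
    | c where "l = {(x, y). 1 * x + 1 * y + (- real_of_int c) = 0}"
    by (auto simp: axis_diagonal_lines_def)
  then show "is_line l"
    by cases (unfold is_line_iff_equation, (metis prod.inject zero_neq_one)+)
next
  fix l assume "l \<in> axis_diagonal_lines x0 y0 k"
  then show "real_point (x0, y0) \<notin> l"
    by (auto simp: axis_diagonal_lines_def real_point_def simp flip: of_int_add)
next
  fix Q assume Q: "Q \<in> H - {(x0, y0)}"
  obtain x y where xy: "Q = (x, y)" by fastforce
  have H: "0 \<le> x" "0 \<le> y" "y0 \<le> y \<Longrightarrow> x + y \<le> k"
    using assms[of x y] Q xy by auto
  \<comment> \<open>A point neither below nor to the left of \<open>(x0, y0)\<close> and different
    from it has a strictly larger coordinate sum.\<close>
  consider "y < y0" | "x < x0" | "y0 \<le> y" "x0 + y0 < x + y"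
    using Q xy by fastforce
  then show "\<exists>l\<in>axis_diagonal_lines x0 y0 k. real_point Q \<in> l"
  proof cases
    case 1
    then show ?thesis using H xy
      by (intro bexI[of _ "{(x, y'). y' = real_of_int y}"])
         (auto simp: axis_diagonal_lines_def real_point_def)
  next
    case 2
    then show ?thesis using H xy
      by (intro bexI[of _ "{(x', y). x' = real_of_int x}"])
         (auto simp: axis_diagonal_lines_def real_point_def)
  next
    case 3
    then have "x + y \<in> {x0 + y0<..k}" using H by simp
    then have "{(x', y'). x' + y' = real_of_int (x + y)} \<in> axis_diagonal_lines x0 y0 k"
      unfolding axis_diagonal_lines_def by blast
    then show ?thesis using xy
      by (intro bexI) (auto simp: real_point_def)
  qed
qed

section \<open>The value \<open>k\<close> and the geometry of the grid\<close>

theorem theorem1p3: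
  fixes m n x0 y0 :: int
  assumes "2 \<le> m" and "m \<le> n"
    and "(x0, y0) \<in> half_rect_grid m n"
  shows "is_min_cover_number (half_rect_grid m n) (x0, y0)
           (n - \<lceil>real_of_int (n - m) / real_of_int (m - 1) * real_of_int y0\<rceil> - 1)"
proof -
  define k where "k = n - \<lceil>real_of_int (n - m) / real_of_int (m - 1) * real_of_int y0\<rceil> - 1"
  have le_k_iff: "z \<le> k \<longleftrightarrow> (m - 1) * z + (n - m) * y0 \<le> (m - 1) * (n - 1)" for z
  proof -
    have "z \<le> k \<longleftrightarrow> \<lceil>real_of_int (n - m) / real_of_int (m - 1) * real_of_int y0\<rceil> \<le> n - 1 - z"
      by (auto simp: k_def)
    also have "\<dots> \<longleftrightarrow> real_of_int (n - m) * real_of_int y0 \<le> real_of_int (n - 1 - z) * real_of_int (m - 1)"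
      using assms(1) by (simp add: ceiling_le_iff pos_divide_le_eq)
    also have "\<dots> \<longleftrightarrow> (n - m) * y0 \<le> (n - 1 - z) * (m - 1)"
      by (simp only: of_int_mult[symmetric] of_int_le_iff)
    also have "\<dots> \<longleftrightarrow> (m - 1) * z + (n - m) * y0 \<le> (m - 1) * (n - 1)"
      by (auto simp: algebra_simps)
    finally show ?thesis .
  qed
  let ?H = "half_rect_grid m n"
  have P: "0 \<le> x0" "0 \<le> y0" "(m - 1) * x0 + (n - 1) * y0 \<le> (m - 1) * (n - 1)"
    using assms(3) by (auto simp: half_rect_grid_def)
  have k: "x0 + y0 \<le> k"
    unfolding le_k_iff using P(3) by (simp add: algebra_simps)
  \<comment> \<open>The grid inequality is tightest at the corner \<open>(k - y0, y0)\<close>, where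
    it becomes \<open>le_k_iff\<close> for \<open>z = k\<close>.\<close>
  have "{0..k - y0} \<times> {0..y0} \<subseteq> ?H"
  proof clarify
    fix x y assume xy: "x \<in> {0..k - y0}" "y \<in> {0..y0}"
    have "(m - 1) * x + (n - 1) * y \<le> (m - 1) * (k - y0) + (n - 1) * y0"
      using xy assms(1,2) by (intro add_mono mult_left_mono) auto
    also have "\<dots> \<le> (m - 1) * (n - 1)"
      using le_k_iff[of k] by (simp add: algebra_simps)
    finally have le: "(m - 1) * x + (n - 1) * y \<le> (m - 1) * (n - 1)" .
    have "0 \<le> (m - 1) * x" "0 \<le> (n - 1) * y" using xy assms(1,2) by auto
    \<comment> \<open>Dropping either nonnegative summand and cancelling a positive factor yields
      the bounding box.\<close>
    with le have "(m - 1) * x \<le> (m - 1) * (n - 1)" "(n - 1) * y \<le> (n - 1) * (m - 1)"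
      by (auto simp: mult.commute)
    then have "x \<le> n - 1" "y \<le> m - 1"
      using assms(1,2) by auto
    with le xy show "(x, y) \<in> ?H" by (auto simp: half_rect_grid_def)
  qed
  then have lower: "k \<le> int (card L)" if "covers_all_but L ?H (x0, y0)" for L
    using card_cover_rectangle_ge[OF that, of "k - y0" y0] P k by simp
  have "covers_all_but (axis_diagonal_lines x0 y0 k) ?H (x0, y0)"
  proof (rule axis_diagonal_lines_cover)
    fix x y assume xy: "(x, y) \<in> ?H"
    have "x + y \<le> k" if "y0 \<le> y"
    proof -
      \<comment> \<open>The grid inequality reads
        \<open>(m - 1) * (x + y) + (n - m) * y \<le> (m - 1) * (n - 1)\<close>; as
        \<open>n - m \<ge> 0\<close>, \<open>y\<close> may be lowered to \<open>y0\<close>.\<close>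
      have "(n - m) * y0 \<le> (n - m) * y"
        using that assms(2) by (intro mult_left_mono) auto
      then show ?thesis
        unfolding le_k_iff using xy by (auto simp: half_rect_grid_def algebra_simps)
    qed
    then show "0 \<le> x \<and> 0 \<le> y \<and> (y0 \<le> y \<longrightarrow> x + y \<le> k)"
      using xy by (auto simp: half_rect_grid_def)
  qed
  \<comment> \<open>The lower bound, applied to this very cover, turns the estimate of its size into
    an equality.\<close>
  moreover from lower[OF this] have "int (card (axis_diagonal_lines x0 y0 k)) = k"
    using card_axis_diagonal_lines_le[OF P(1,2) k] by simp
  ultimately show ?thesis
    using lower unfolding is_min_cover_number_def k_def[symmetric] by blast
qed

end
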